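(* Every locally null rotation isotropic spacetime $(M,g_{ab})$ admits (locally) a multiply-transitive isometry group $G_r$ of dimension $r\geq 3$.
   Context: **Spacetime.** A spacetime is a (sufficiently smooth) 4-dimensional Lorentzian manifold $(M,g_{ab})$ of signature $(-,+,+,+)$. The statement is local, near a point $P_o$. **Null rotations.** Let $(k,l,m,\bar m)$ be a complex null tetrad of the tangent space $T_PM$ ($k,l$ real null, $m$ complex null, $k\cdot l=-1$, $m\cdot\bar m=1$, other products zero). A null rotation about $k$ is a Lorentz transformation of $T_PM$ of the form $$k\mapsto k,\qquad m\mapsto m+\bar B k,\qquad l\mapsto l+Bm+\bar B\bar m+B\bar B k,\qquad B\in\mathbb{C}.$$ **Locally null rotation isotropic.** There is a local group of motions (isometries) $G_r$, of dimension $r$, in an open neighbourhood $W$ of $P_o$, which is multiply transitive on some $q$-dimensional surface through each point $P$ of $W$ (i.e. its orbits have dimension $q$, with isotropy subgroups of positive dimension), and such that for each $P\in W$ its isotropy subgroup at $P$ contains (continuous) isometries fixing $P$ whose action on $T_PM$ is by null rotations. *)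

theory Defs
  imports "HOL-Analysis.Analysis"
begin

section \<open>Smooth maps, manifolds, spacetimes\<close>

text \<open>\<open>Ck_on k S f\<close>: \<open>f\<close> is of class \<open>C\<^sup>k\<close> on \<open>S\<close>.  Only meant for open \<open>S\<close>.\<close>

primrec Ck_on ::
  "nat \<Rightarrow> 'a::euclidean_space set \<Rightarrow> ('a \<Rightarrow> 'b::real_normed_vector) \<Rightarrow> bool" where
  "Ck_on 0 S f \<longleftrightarrow> continuous_on S f"
| "Ck_on (Suc k) S f \<longleftrightarrow>
     (\<forall>x\<in>S. f differentiable (at x)) \<and>
     (\<forall>v. Ck_on k S (\<lambda>x. frechet_derivative f (at x) v))"

definition smooth_on ::
  "'a::euclidean_space set \<Rightarrow> ('a \<Rightarrow> 'b::real_normed_vector) \<Rightarrow> bool" where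
  "smooth_on S f \<longleftrightarrow> (\<forall>k. Ck_on k S f)"

text \<open>A chart is a pair of an open domain and a coordinate map, a homeomorphism of the domain
  onto an open subset of \<open>\<real>\<^sup>4\<close>; the values of the map outside the domain are irrelevant.\<close>

type_synonym 'a chart = "'a set \<times> ('a \<Rightarrow> real^4)"

abbreviation domain :: "'a chart \<Rightarrow> 'a set" where
  "domain c \<equiv> fst c"

abbreviation coord :: "'a chart \<Rightarrow> 'a \<Rightarrow> real^4" where
  "coord c \<equiv> snd c"

definition coord_inv :: "'a chart \<Rightarrow> real^4 \<Rightarrow> 'a" where
  "coord_inv c = inv_into (domain c) (coord c)"

definition is_chart :: "'a::topological_space chart \<Rightarrow> bool" where
  "is_chart c \<longleftrightarrow>
     open (domain c) \<and> open (coord c ` domain c) \<and>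
     homeomorphism (domain c) (coord c ` domain c) (coord c) (coord_inv c)"

definition smooth_atlas :: "'a::topological_space chart set \<Rightarrow> bool" where
  "smooth_atlas A \<longleftrightarrow>
     (\<forall>c\<in>A. is_chart c) \<and>
     (\<forall>c\<in>A. \<forall>c'\<in>A. smooth_on (coord c ` (domain c \<inter> domain c')) (coord c' \<circ> coord_inv c))"

definition manifold :: "'a chart set \<Rightarrow> 'a set" where
  "manifold A = (\<Union>c\<in>A. domain c)"

text \<open>The differential at \<open>P\<close> of a map \<open>f\<close> (defined near \<open>P\<close>), as a matrix with respect to the
  coordinate bases of \<open>c\<close> at \<open>P\<close> and of \<open>c'\<close> at \<open>f P\<close>.  Tangent vectors at \<open>P\<close> are represented
  throughout by their components in a chart around \<open>P\<close>.\<close>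

definition differential ::
  "'a chart \<Rightarrow> 'a chart \<Rightarrow> ('a \<Rightarrow> 'a) \<Rightarrow> 'a \<Rightarrow> real^4^4" where
  "differential c c' f P =
     matrix (frechet_derivative (coord c' \<circ> f \<circ> coord_inv c) (at (coord c P)))"

definition minkowski :: "real^4^4" where
  "minkowski = (\<chi> i j. if i \<noteq> j then 0 else if i = 1 then - 1 else 1)"

definition lorentz_form :: "real^4^4 \<Rightarrow> bool" where
  "lorentz_form G \<longleftrightarrow> (\<exists>E. invertible E \<and> transpose E ** G ** E = minkowski)"

text \<open>\<open>g c P\<close> is the matrix of components of the metric at \<open>P\<close> in the chart \<open>c\<close>; the last clause
  is the transformation law of a covariant 2-tensor.\<close>

type_synonym 'a metric_field = "'a chart \<Rightarrow> 'a \<Rightarrow> real^4^4"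

definition spacetime ::
  "'a::{t2_space, second_countable_topology} chart set \<Rightarrow> 'a metric_field \<Rightarrow> bool" where
  "spacetime A g \<longleftrightarrow>
     smooth_atlas A \<and>
     (\<forall>c\<in>A. smooth_on (coord c ` domain c) (\<lambda>x. g c (coord_inv c x))) \<and>
     (\<forall>c\<in>A. \<forall>P\<in>domain c. transpose (g c P) = g c P \<and> lorentz_form (g c P)) \<and>
     (\<forall>c\<in>A. \<forall>c'\<in>A. \<forall>P\<in>domain c \<inter> domain c'.
        g c P = transpose (differential c c' id P) ** g c' P ** differential c c' id P)"

section \<open>Null rotations\<close>

definition cvec :: "real^4 \<Rightarrow> complex^4" where
  "cvec x = (\<chi> i. complex_of_real (x $ i))"

definition cvec_cnj :: "complex^4 \<Rightarrow> complex^4" where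
  "cvec_cnj u = (\<chi> i. cnj (u $ i))"

definition cmat :: "real^4^4 \<Rightarrow> complex^4^4" where
  "cmat T = (\<chi> i j. complex_of_real (T $ i $ j))"

text \<open>The complex-bilinear (not sesquilinear) extension of a real bilinear form.\<close>

definition cform :: "real^4^4 \<Rightarrow> complex^4 \<Rightarrow> complex^4 \<Rightarrow> complex" where
  "cform G u v = (\<Sum>i\<in>UNIV. \<Sum>j\<in>UNIV. complex_of_real (G $ i $ j) * u $ i * v $ j)"

text \<open>The products not listed vanish as complex conjugates of listed ones.\<close>

definition null_tetrad :: "real^4^4 \<Rightarrow> real^4 \<Rightarrow> real^4 \<Rightarrow> complex^4 \<Rightarrow> bool" where
  "null_tetrad G k l m \<longleftrightarrow>
     cform G (cvec k) (cvec k) = 0 \<and> cform G (cvec l) (cvec l) = 0 \<and> cform G m m = 0 \<and>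
     cform G (cvec k) (cvec l) = - 1 \<and> cform G m (cvec_cnj m) = 1 \<and>
     cform G (cvec k) m = 0 \<and> cform G (cvec l) m = 0"

definition null_rotation :: "real^4^4 \<Rightarrow> real^4 \<Rightarrow> real^4^4 \<Rightarrow> bool" where
  "null_rotation G k T \<longleftrightarrow>
     (\<exists>l m B. null_tetrad G k l m \<and>
        T *v k = k \<and>
        cmat T *v m = m + cnj B *s cvec k \<and>
        cmat T *v cvec l = cvec l + B *s m + cnj B *s cvec_cnj m + (B * cnj B) *s cvec k)"

section \<open>Local groups of motions\<close>

text \<open>A local Lie group of dimension \<open>CARD('r)\<close>, in coordinates centred at the identity (Olver,
  Applications of Lie Groups to Differential Equations, Section 1.2): the multiplication is
  defined on \<open>params \<times> params\<close> with values in \<open>\<real>\<^sup>r\<close>, the inversion on \<open>inv_params\<close>.\<close>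

record 'r local_group =
  params :: "(real^'r) set"
  inv_params :: "(real^'r) set"
  gmult :: "real^'r \<Rightarrow> real^'r \<Rightarrow> real^'r"
  ginv :: "real^'r \<Rightarrow> real^'r"

definition local_lie_group :: "'r::finite local_group \<Rightarrow> bool" where
  "local_lie_group G \<longleftrightarrow>
     open (params G) \<and> connected (params G) \<and>
     open (inv_params G) \<and> connected (inv_params G) \<and>
     0 \<in> inv_params G \<and> inv_params G \<subseteq> params G \<and>
     smooth_on (params G \<times> params G) (\<lambda>(a, b). gmult G a b) \<and>
     smooth_on (inv_params G) (ginv G) \<and> ginv G ` inv_params G \<subseteq> params G \<and>
     (\<forall>a\<in>params G. \<forall>b\<in>params G. \<forall>d\<in>params G.
        gmult G a b \<in> params G \<longrightarrow> gmult G b d \<in> params G \<longrightarrow>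
        gmult G a (gmult G b d) = gmult G (gmult G a b) d) \<and>
     (\<forall>a\<in>params G. gmult G 0 a = a \<and> gmult G a 0 = a) \<and>
     (\<forall>a\<in>inv_params G. gmult G a (ginv G a) = 0 \<and> gmult G (ginv G a) a = 0)"

definition one_param_subgroup ::
  "'r::finite local_group \<Rightarrow> real \<Rightarrow> (real \<Rightarrow> real^'r) \<Rightarrow> bool" where
  "one_param_subgroup G \<epsilon> \<gamma> \<longleftrightarrow>
     \<epsilon> > 0 \<and> smooth_on {-\<epsilon><..<\<epsilon>} \<gamma> \<and> \<gamma> ` {-\<epsilon><..<\<epsilon>} \<subseteq> params G \<and> \<gamma> 0 = 0 \<and>
     (\<forall>s t. \<bar>s\<bar> < \<epsilon> \<longrightarrow> \<bar>t\<bar> < \<epsilon> \<longrightarrow> \<bar>s + t\<bar> < \<epsilon> \<longrightarrow> \<gamma> (s + t) = gmult G (\<gamma> s) (\<gamma> t))"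

text \<open>A local group of transformations of \<open>W\<close> (Olver, loc. cit.): \<open>D\<close> is the domain of definition
  of the action \<open>\<Psi>\<close>.  Continuity of \<open>\<Psi>\<close> makes the sets on which the coordinate expressions are
  required to be smooth open.\<close>

definition local_transformation_group ::
  "'a::topological_space chart set \<Rightarrow> 'a set \<Rightarrow> 'r::finite local_group \<Rightarrow>
   ((real^'r) \<times> 'a) set \<Rightarrow> (real^'r \<Rightarrow> 'a \<Rightarrow> 'a) \<Rightarrow> bool" where
  "local_transformation_group A W G D \<Psi> \<longleftrightarrow>
     local_lie_group G \<and> open W \<and> W \<subseteq> manifold A \<and>
     open D \<and> {0} \<times> W \<subseteq> D \<and> D \<subseteq> params G \<times> W \<and>
     (\<forall>(a, P)\<in>D. \<Psi> a P \<in> W) \<and>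
     continuous_on D (\<lambda>(a, P). \<Psi> a P) \<and>
     (\<forall>c\<in>A. \<forall>c'\<in>A.
        smooth_on {(a, x). x \<in> coord c ` domain c \<and> (a, coord_inv c x) \<in> D \<and>
                           \<Psi> a (coord_inv c x) \<in> domain c'}
                  (\<lambda>(a, x). coord c' (\<Psi> a (coord_inv c x)))) \<and>
     (\<forall>P\<in>W. \<Psi> 0 P = P) \<and>
     (\<forall>a b P. (b, P) \<in> D \<longrightarrow> (a, \<Psi> b P) \<in> D \<longrightarrow> (gmult G a b, P) \<in> D \<longrightarrow>
        \<Psi> a (\<Psi> b P) = \<Psi> (gmult G a b) P) \<and>
     (\<forall>a P. (a, P) \<in> D \<longrightarrow> a \<in> inv_params G \<longrightarrow>
        (ginv G a, \<Psi> a P) \<in> D \<and> \<Psi> (ginv G a) (\<Psi> a P) = P)"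

text \<open>All parameters of the group are essential: no nontrivial one-parameter subgroup acts
  trivially.  This makes \<open>CARD('r)\<close> the dimension of the group of transformations.\<close>

definition effective_action ::
  "'a set \<Rightarrow> 'r::finite local_group \<Rightarrow> ((real^'r) \<times> 'a) set \<Rightarrow> (real^'r \<Rightarrow> 'a \<Rightarrow> 'a) \<Rightarrow> bool" where
  "effective_action W G D \<Psi> \<longleftrightarrow>
     (\<forall>\<epsilon> \<gamma>. one_param_subgroup G \<epsilon> \<gamma> \<longrightarrow>
        (\<forall>t\<in>{-\<epsilon><..<\<epsilon>}. \<forall>P\<in>W. (\<gamma> t, P) \<in> D \<longrightarrow> \<Psi> (\<gamma> t) P = P) \<longrightarrow>
        (\<forall>t\<in>{-\<epsilon><..<\<epsilon>}. \<gamma> t = 0))"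

definition acts_by_isometries ::
  "'a chart set \<Rightarrow> 'a metric_field \<Rightarrow>
   ((real^'r::finite) \<times> 'a) set \<Rightarrow> (real^'r \<Rightarrow> 'a \<Rightarrow> 'a) \<Rightarrow> bool" where
  "acts_by_isometries A g D \<Psi> \<longleftrightarrow>
     (\<forall>(a, P)\<in>D. \<forall>c\<in>A. \<forall>c'\<in>A. P \<in> domain c \<longrightarrow> \<Psi> a P \<in> domain c' \<longrightarrow>
        g c P = transpose (differential c c' (\<Psi> a) P) ** g c' (\<Psi> a P)
                  ** differential c c' (\<Psi> a) P)"

definition group_of_motions ::
  "'a::topological_space chart set \<Rightarrow> 'a metric_field \<Rightarrow> 'a set \<Rightarrow> 'r::finite local_group \<Rightarrow>
   ((real^'r) \<times> 'a) set \<Rightarrow> (real^'r \<Rightarrow> 'a \<Rightarrow> 'a) \<Rightarrow> bool" where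
  "group_of_motions A g W G D \<Psi> \<longleftrightarrow>
     local_transformation_group A W G D \<Psi> \<and> effective_action W G D \<Psi> \<and>
     acts_by_isometries A g D \<Psi>"

section \<open>Orbits and isotropy\<close>

definition isotropy_subgroup ::
  "((real^'r::finite) \<times> 'a) set \<Rightarrow> (real^'r \<Rightarrow> 'a \<Rightarrow> 'a) \<Rightarrow> 'a \<Rightarrow> (real^'r) set" where
  "isotropy_subgroup D \<Psi> P = {a. (a, P) \<in> D \<and> \<Psi> a P = P}"

text \<open>The Lie algebra of the isotropy subgroup: the initial velocities of the one-parameter
  subgroups lying in it.\<close>

definition isotropy_algebra ::
  "'r::finite local_group \<Rightarrow> ((real^'r) \<times> 'a) set \<Rightarrow> (real^'r \<Rightarrow> 'a \<Rightarrow> 'a) \<Rightarrow> 'a \<Rightarrow> (real^'r) set"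
  where
  "isotropy_algebra G D \<Psi> P =
     {v. \<exists>\<epsilon> \<gamma>. one_param_subgroup G \<epsilon> \<gamma> \<and> \<gamma> ` {-\<epsilon><..<\<epsilon>} \<subseteq> isotropy_subgroup D \<Psi> P \<and>
               (\<gamma> has_vector_derivative v) (at 0)}"

text \<open>The tangent space at \<open>P\<close> of the orbit of \<open>P\<close>, in the chart \<open>c\<close>: the image of the
  differential at the identity of the orbit map.\<close>

definition orbit_tangent ::
  "'a chart \<Rightarrow> (real^'r::finite \<Rightarrow> 'a \<Rightarrow> 'a) \<Rightarrow> 'a \<Rightarrow> (real^4) set" where
  "orbit_tangent c \<Psi> P = range (frechet_derivative (\<lambda>a. coord c (\<Psi> a P)) (at 0))"

definition multiply_transitive ::
  "'a chart set \<Rightarrow> 'a set \<Rightarrow> 'r::finite local_group \<Rightarrow>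
   ((real^'r) \<times> 'a) set \<Rightarrow> (real^'r \<Rightarrow> 'a \<Rightarrow> 'a) \<Rightarrow> bool" where
  "multiply_transitive A W G D \<Psi> \<longleftrightarrow>
     (\<exists>q. \<forall>P\<in>W. (\<forall>c\<in>A. P \<in> domain c \<longrightarrow> dim (orbit_tangent c \<Psi> P) = q) \<and>
                dim (isotropy_algebra G D \<Psi> P) > 0)"

text \<open>The isotropy subgroup at \<open>P\<close> contains a one-parameter subgroup which acts on the tangent
  space at \<open>P\<close> nontrivially, by null rotations.\<close>

definition null_rotation_isotropy ::
  "'a chart set \<Rightarrow> 'a metric_field \<Rightarrow> 'r::finite local_group \<Rightarrow>
   ((real^'r) \<times> 'a) set \<Rightarrow> (real^'r \<Rightarrow> 'a \<Rightarrow> 'a) \<Rightarrow> 'a \<Rightarrow> bool" where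
  "null_rotation_isotropy A g G D \<Psi> P \<longleftrightarrow>
     (\<exists>\<epsilon> \<gamma>. one_param_subgroup G \<epsilon> \<gamma> \<and> \<gamma> ` {-\<epsilon><..<\<epsilon>} \<subseteq> isotropy_subgroup D \<Psi> P \<and>
        (\<forall>c\<in>A. P \<in> domain c \<longrightarrow>
           (\<exists>k. \<forall>t\<in>{-\<epsilon><..<\<epsilon>}. null_rotation (g c P) k (differential c c (\<Psi> (\<gamma> t)) P)) \<and>
           (\<exists>t\<in>{-\<epsilon><..<\<epsilon>}. differential c c (\<Psi> (\<gamma> t)) P \<noteq> mat 1)))"

text \<open>The type argument fixes the dimension \<open>r = CARD('r)\<close> of the group.\<close>

definition locally_null_rotation_isotropic ::
  "'r::finite itself \<Rightarrow> 'a::{t2_space, second_countable_topology} chart set \<Rightarrow>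
   'a metric_field \<Rightarrow> 'a \<Rightarrow> bool" where
  "locally_null_rotation_isotropic TYPE('r) A g P\<^sub>o \<longleftrightarrow>
     (\<exists>W (G :: 'r local_group) D \<Psi>.
        P\<^sub>o \<in> W \<and> group_of_motions A g W G D \<Psi> \<and> multiply_transitive A W G D \<Psi> \<and>
        (\<forall>P\<in>W. null_rotation_isotropy A g G D \<Psi> P))"

end

theory Submission
  imports Defs
begin

text \<open>The group given by the hypothesis already has dimension at least 3.  Suppose \<open>r \<le> 2\<close>.  Since the
  isotropy has positive dimension, the orbits have dimension at most 1, so near \<open>P\<^sub>o\<close> the Killing
  field \<open>Y\<close> generating the null rotations at \<open>P\<^sub>o\<close> is a multiple \<open>f X\<close> of a nowhere vanishing Killing
  field \<open>X\<close> (or all generators vanish, because the orbit dimension is constant).  The Killing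
  equations force \<open>f\<close> to be constant near \<open>P\<^sub>o\<close>, and \<open>f = 0\<close> at \<open>P\<^sub>o\<close>; hence \<open>Y = 0\<close> near \<open>P\<^sub>o\<close>, its
  flow is the identity there, and the isotropy acts trivially on the tangent space at \<open>P\<^sub>o\<close>, contrary
  to the hypothesis on null rotations.\<close>

section \<open>Smooth maps and their derivatives\<close>

lemma isCont_imp_tendsto_nhds: "isCont f x \<Longrightarrow> (f \<longlongrightarrow> f x) (nhds x)"
  by (simp add: isCont_def tendsto_at_iff_tendsto_nhds[of f x])

lemma smooth_on_imp_differentiable:
  assumes "smooth_on S f" "x \<in> S"
  shows "f differentiable (at x)"
proof -
  have "Ck_on (Suc 0) S f" using assms(1) unfolding smooth_on_def by blast
  thus ?thesis using assms(2) by simp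
qed

lemma smooth_on_imp_has_derivative:
  assumes "smooth_on S f" "x \<in> S"
  shows "(f has_derivative frechet_derivative f (at x)) (at x)"
  using smooth_on_imp_differentiable[OF assms] frechet_derivative_works by blast

lemma smooth_on_frechet_derivative:
  assumes "smooth_on S f"
  shows "smooth_on S (\<lambda>x. frechet_derivative f (at x) v)"
  unfolding smooth_on_def
proof
  fix k
  have "Ck_on (Suc k) S f" using assms unfolding smooth_on_def by blast
  thus "Ck_on k S (\<lambda>x. frechet_derivative f (at x) v)" by simp
qed

lemma smooth_on_imp_continuous_on:
  assumes "smooth_on S f"
  shows "continuous_on S f"
proof -
  have "Ck_on 0 S f" using assms unfolding smooth_on_def by blast
  thus ?thesis by simp
qed

section \<open>Symmetry of second derivatives\<close>

text \<open>Two applications of the mean value theorem to the second difference of \<open>f\<close> over the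
  parallelogram spanned by \<open>s u\<close> and \<open>s v\<close>.\<close>

lemma second_difference_mean_value:
  fixes f :: "'a::real_normed_vector \<Rightarrow> real"
  assumes "s > 0"
    and ball: "\<And>\<theta> \<eta>. \<lbrakk>0 \<le> \<theta>; \<theta> \<le> s; 0 \<le> \<eta>; \<eta> \<le> s\<rbrakk> \<Longrightarrow> x + \<theta> *\<^sub>R u + \<eta> *\<^sub>R v \<in> S"
    and f: "\<And>y. y \<in> S \<Longrightarrow> (f has_derivative f' y) (at y)"
    and fu: "\<And>y. y \<in> S \<Longrightarrow> ((\<lambda>y. f' y u) has_derivative f'' y) (at y)"
  obtains \<theta> \<eta> where "0 \<le> \<theta>" "\<theta> \<le> s" "0 \<le> \<eta>" "\<eta> \<le> s"
    "f (x + s *\<^sub>R u + s *\<^sub>R v) - f (x + s *\<^sub>R u) - f (x + s *\<^sub>R v) + f x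
       = s\<^sup>2 * f'' (x + \<theta> *\<^sub>R u + \<eta> *\<^sub>R v) v"
proof -
  \<comment> \<open>\<open>d \<theta>\<close> is the increment of \<open>f\<close> along
    \<open>s v\<close> from \<open>x + \<theta> u\<close>, so the second difference is
    \<open>d s - d 0\<close>.\<close>
  define d where "d = (\<lambda>\<theta>. f (x + \<theta> *\<^sub>R u + s *\<^sub>R v) - f (x + \<theta> *\<^sub>R u))"
  have lin: "linear (f' y)" if "y \<in> S" for y
    using f[OF that] has_derivative_linear by blast
  have lin2: "linear (f'' y)" if "y \<in> S" for y
    using fu[OF that] has_derivative_linear by blast
  have d: "(d has_derivative (\<lambda>r. f' (x + \<theta> *\<^sub>R u + s *\<^sub>R v) (r *\<^sub>R u) - f' (x + \<theta> *\<^sub>R u) (r *\<^sub>R u)))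
      (at \<theta> within {0..s})" if "0 \<le> \<theta>" "\<theta> \<le> s" for \<theta>
  proof -
    have 1: "((\<lambda>\<theta>. f (x + \<theta> *\<^sub>R u + s *\<^sub>R v)) has_derivative
        (\<lambda>r. f' (x + \<theta> *\<^sub>R u + s *\<^sub>R v) (r *\<^sub>R u))) (at \<theta> within {0..s})"
      by (rule has_derivative_compose[where f = "\<lambda>\<theta>. x + \<theta> *\<^sub>R u + s *\<^sub>R v"])
        (use assms(1) that in \<open>auto intro!: derivative_eq_intros f ball\<close>)
    have 2: "((\<lambda>\<theta>. f (x + \<theta> *\<^sub>R u)) has_derivative
        (\<lambda>r. f' (x + \<theta> *\<^sub>R u) (r *\<^sub>R u))) (at \<theta> within {0..s})"
      by (rule has_derivative_compose[where f = "\<lambda>\<theta>. x + \<theta> *\<^sub>R u"])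
        (use ball[of \<theta> 0] assms(1) that in \<open>auto intro!: derivative_eq_intros f\<close>)
    show ?thesis unfolding d_def by (intro has_derivative_diff 1 2)
  qed
  obtain \<theta> where \<theta>: "\<theta> \<in> {0..s}"
    "d s - d 0 = f' (x + \<theta> *\<^sub>R u + s *\<^sub>R v) ((s - 0) *\<^sub>R u) - f' (x + \<theta> *\<^sub>R u) ((s - 0) *\<^sub>R u)"
    using mvt_very_simple[of 0 s d, OF _ d] assms(1) by auto
  have S: "x + \<theta> *\<^sub>R u + \<eta> *\<^sub>R v \<in> S" if "0 \<le> \<eta>" "\<eta> \<le> s" for \<eta>
    using ball \<theta>(1) that by auto
  have e: "((\<lambda>\<eta>. f' (x + \<theta> *\<^sub>R u + \<eta> *\<^sub>R v) u) has_derivative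
      (\<lambda>r. f'' (x + \<theta> *\<^sub>R u + \<eta> *\<^sub>R v) (r *\<^sub>R v))) (at \<eta> within {0..s})"
    if "0 \<le> \<eta>" "\<eta> \<le> s" for \<eta>
    by (rule has_derivative_compose[where f = "\<lambda>\<eta>. x + \<theta> *\<^sub>R u + \<eta> *\<^sub>R v"])
      (use that in \<open>auto intro!: derivative_eq_intros fu S\<close>)
  obtain \<eta> where \<eta>: "\<eta> \<in> {0..s}"
    "f' (x + \<theta> *\<^sub>R u + s *\<^sub>R v) u - f' (x + \<theta> *\<^sub>R u + 0 *\<^sub>R v) u
      = f'' (x + \<theta> *\<^sub>R u + \<eta> *\<^sub>R v) ((s - 0) *\<^sub>R v)"
    using mvt_very_simple[of 0 s "\<lambda>\<eta>. f' (x + \<theta> *\<^sub>R u + \<eta> *\<^sub>R v) u", OF _ e] assms(1) by auto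
  have "d s - d 0 = s * (f' (x + \<theta> *\<^sub>R u + s *\<^sub>R v) u - f' (x + \<theta> *\<^sub>R u + 0 *\<^sub>R v) u)"
    using \<theta>(2) lin[OF S[of s]] lin[OF S[of 0]] assms(1) by (simp add: linear_scale algebra_simps)
  also have "\<dots> = s\<^sup>2 * f'' (x + \<theta> *\<^sub>R u + \<eta> *\<^sub>R v) v"
    unfolding \<eta>(2) using lin2[OF S[of \<eta>]] \<eta>(1) by (simp add: linear_scale power2_eq_square)
  finally show thesis
    using that[of \<theta> \<eta>] \<theta>(1) \<eta>(1) by (simp add: d_def)
qed

text \<open>The second difference is symmetric in \<open>u\<close> and \<open>v\<close>. Evaluated
  in the two orders, it gives equal values of \<open>fu _ v\<close> and \<open>fv _ u\<close> at two
  points close to \<open>x\<close>, and continuity at \<open>x\<close> carries the equality over to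
  \<open>x\<close> up to any \<open>e > 0\<close>.\<close>

lemma symmetric_second_derivative_real:
  fixes f :: "'a::real_normed_vector \<Rightarrow> real"
  assumes "open S" "x \<in> S"
    and f: "\<And>y. y \<in> S \<Longrightarrow> (f has_derivative f' y) (at y)"
    and fu: "\<And>y. y \<in> S \<Longrightarrow> ((\<lambda>y. f' y u) has_derivative fu y) (at y)"
    and fv: "\<And>y. y \<in> S \<Longrightarrow> ((\<lambda>y. f' y v) has_derivative fv y) (at y)"
    and cu: "isCont (\<lambda>y. fu y v) x" and cv: "isCont (\<lambda>y. fv y u) x"
  shows "fu x v = fv x u"
proof -
  have "\<bar>fu x v - fv x u\<bar> \<le> e" if "e > 0" for e
  proof -
    have "\<forall>\<^sub>F y in nhds x. y \<in> S"
      using assms(1,2) eventually_nhds_in_open by blast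
    moreover have "\<forall>\<^sub>F y in nhds x. dist (fu y v) (fu x v) < e / 2"
      using tendstoD[OF isCont_imp_tendsto_nhds[OF cu], of "e / 2"] \<open>e > 0\<close>
      by simp
    moreover have "\<forall>\<^sub>F y in nhds x. dist (fv y u) (fv x u) < e / 2"
      using tendstoD[OF isCont_imp_tendsto_nhds[OF cv], of "e / 2"] \<open>e > 0\<close>
      by simp
    ultimately have "\<forall>\<^sub>F y in nhds x. y \<in> S \<and> dist (fu y v) (fu x v) < e / 2 \<and>
        dist (fv y u) (fv x u) < e / 2"
      by eventually_elim auto
    then obtain d where d: "d > 0" "\<And>y. dist y x < d \<Longrightarrow> y \<in> S \<and> dist (fu y v) (fu x v) < e / 2 \<and>
        dist (fv y u) (fv x u) < e / 2"
      unfolding eventually_nhds_metric by blast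
    \<comment> \<open>The step \<open>s\<close> is small enough for the whole parallelogram spanned
      by \<open>s u\<close> and \<open>s v\<close> to lie within distance \<open>d\<close> of
      \<open>x\<close>; the summand 1 keeps \<open>N\<close> positive even for
      \<open>u = v = 0\<close>.\<close>
    define N where "N = norm u + norm v + 1"
    have N: "N > 0" unfolding N_def by (smt (verit) norm_ge_zero)
    define s where "s = d / (2 * N)"
    have s: "s > 0" using d(1) N by (simp add: s_def)
    have near: "dist (x + \<theta> *\<^sub>R u + \<eta> *\<^sub>R v) x < d"
      if "0 \<le> \<theta>" "\<theta> \<le> s" "0 \<le> \<eta>" "\<eta> \<le> s" for \<theta> \<eta>
    proof -
      have "dist (x + \<theta> *\<^sub>R u + \<eta> *\<^sub>R v) x = norm (\<theta> *\<^sub>R u + \<eta> *\<^sub>R v)"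
        by (simp add: dist_norm algebra_simps)
      also have "\<dots> \<le> norm (\<theta> *\<^sub>R u) + norm (\<eta> *\<^sub>R v)"
        by (rule norm_triangle_ineq)
      also have "\<dots> \<le> s * norm u + s * norm v"
        using that by (auto intro!: add_mono mult_right_mono)
      also have "\<dots> \<le> s * N"
        using s by (simp add: N_def algebra_simps)
      also have "\<dots> < d"
        using N d(1) by (simp add: s_def)
      finally show ?thesis .
    qed
    obtain \<theta> \<eta> where 1: "0 \<le> \<theta>" "\<theta> \<le> s" "0 \<le> \<eta>" "\<eta> \<le> s"
      "f (x + s *\<^sub>R u + s *\<^sub>R v) - f (x + s *\<^sub>R u) - f (x + s *\<^sub>R v) + f x
         = s\<^sup>2 * fu (x + \<theta> *\<^sub>R u + \<eta> *\<^sub>R v) v"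
      using second_difference_mean_value[OF s, of x u v S f f' fu] d(2) near f fu by blast
    have near': "dist (x + \<theta> *\<^sub>R v + \<eta> *\<^sub>R u) x < d"
      if "0 \<le> \<theta>" "\<theta> \<le> s" "0 \<le> \<eta>" "\<eta> \<le> s" for \<theta> \<eta>
      using near[of \<eta> \<theta>] that by (simp add: algebra_simps)
    obtain \<theta>' \<eta>' where 2: "0 \<le> \<theta>'" "\<theta>' \<le> s" "0 \<le> \<eta>'" "\<eta>' \<le> s"
      "f (x + s *\<^sub>R v + s *\<^sub>R u) - f (x + s *\<^sub>R v) - f (x + s *\<^sub>R u) + f x
         = s\<^sup>2 * fv (x + \<theta>' *\<^sub>R v + \<eta>' *\<^sub>R u) u"
      using second_difference_mean_value[OF s, of x v u S f f' fv] d(2) near' f fv by blast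
    have swap: "x + s *\<^sub>R v + s *\<^sub>R u = x + s *\<^sub>R u + s *\<^sub>R v"
      by (simp add: add_ac)
    have "s\<^sup>2 * fu (x + \<theta> *\<^sub>R u + \<eta> *\<^sub>R v) v = s\<^sup>2 * fv (x + \<theta>' *\<^sub>R v + \<eta>' *\<^sub>R u) u"
      using 1(5) 2(5)[unfolded swap] by linarith
    hence "fu (x + \<theta> *\<^sub>R u + \<eta> *\<^sub>R v) v = fv (x + \<theta>' *\<^sub>R v + \<eta>' *\<^sub>R u) u"
      using s by simp
    moreover have "dist (fu (x + \<theta> *\<^sub>R u + \<eta> *\<^sub>R v) v) (fu x v) < e / 2"
      using d(2) near 1 by blast
    moreover have "dist (fv (x + \<theta>' *\<^sub>R v + \<eta>' *\<^sub>R u) u) (fv x u) < e / 2"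
      using d(2) near' 2 by blast
    ultimately show ?thesis unfolding dist_real_def by linarith
  qed
  hence "\<bar>fu x v - fv x u\<bar> \<le> 0" by (rule field_le_epsilon) simp
  thus ?thesis by simp
qed

text \<open>The real case applies to each component \<open>f y \<bullet> b\<close>. The result
  serves to exchange a derivative in the group parameter with one in the position.\<close>

lemma symmetric_frechet_derivative:
  fixes f :: "'a::euclidean_space \<Rightarrow> 'b::euclidean_space"
  assumes "open S" "x \<in> S" "smooth_on S f"
  shows "frechet_derivative (\<lambda>y. frechet_derivative f (at y) u) (at x) v
       = frechet_derivative (\<lambda>y. frechet_derivative f (at y) v) (at x) u"
proof (rule euclidean_eqI)
  fix b :: 'b assume "b \<in> Basis"
  have second: "((\<lambda>y. frechet_derivative f (at y) u \<bullet> b) has_derivative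
      (\<lambda>v. frechet_derivative (\<lambda>y. frechet_derivative f (at y) u) (at y) v \<bullet> b)) (at y)"
    if "y \<in> S" for u y
    using smooth_on_imp_has_derivative[OF smooth_on_frechet_derivative[OF assms(3)] that]
    by (rule has_derivative_inner_left)
  have cont: "isCont (\<lambda>y. frechet_derivative (\<lambda>y. frechet_derivative f (at y) u) (at y) v \<bullet> b) x"
    for u v
  proof -
    have "continuous_on S (\<lambda>y. frechet_derivative (\<lambda>y. frechet_derivative f (at y) u) (at y) v)"
      by (intro smooth_on_imp_continuous_on smooth_on_frechet_derivative assms(3))
    thus ?thesis
      using assms(1,2) continuous_on_eq_continuous_at by (intro continuous_intros) blast
  qed
  show "frechet_derivative (\<lambda>y. frechet_derivative f (at y) u) (at x) v \<bullet> b
      = frechet_derivative (\<lambda>y. frechet_derivative f (at y) v) (at x) u \<bullet> b"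
    by (rule symmetric_second_derivative_real[OF assms(1,2), where f = "\<lambda>y. f y \<bullet> b"])
      (auto intro!: second cont has_derivative_inner_left smooth_on_imp_has_derivative[OF assms(3)])
qed

section \<open>Proportional Killing fields\<close>

lemma bounded_bilinear_matrix_vector_mult:
  "bounded_bilinear ((*v) :: real^'n^'m \<Rightarrow> real^'n \<Rightarrow> real^'m)"
  unfolding bilinear_conv_bounded_bilinear[symmetric] bilinear_def
  by (auto intro!: linearI simp: matrix_vector_right_distrib matrix_vector_mult_add_rdistrib
      vec_eq_iff matrix_vector_mult_def sum_distrib_left sum.distrib algebra_simps)

text \<open>The Killing equations of \<open>X\<close> and of \<open>Y = f X\<close> leave \<open>df \<otimes> \<xi> + \<xi> \<otimes> df = 0\<close> for the covector
  \<open>\<xi> = h X\<close>.\<close>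

lemma proportional_Killing_fields:
  fixes h :: "real^'n \<Rightarrow> real^'n^'n" and X Y :: "real^'n \<Rightarrow> real^'n" and f :: "real^'n \<Rightarrow> real"
  assumes X: "(X has_derivative X') (at x)" and Y: "(Y has_derivative Y') (at x)"
    and f: "(f has_derivative f') (at x)"
    and YX: "\<forall>\<^sub>F y in nhds x. Y y = f y *\<^sub>R X y"
    and H: "linear H"
    and KX: "\<And>y z. y \<bullet> (H (X x) *v z) + X' y \<bullet> (h x *v z) + y \<bullet> (h x *v X' z) = 0"
    and KY: "\<And>y z. y \<bullet> (H (Y x) *v z) + Y' y \<bullet> (h x *v z) + y \<bullet> (h x *v Y' z) = 0"
    and sym: "transpose (h x) = h x" and nz: "h x *v X x \<noteq> 0"
  shows "f' = (\<lambda>_. 0)"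
proof -
  have Yx: "Y x = f x *\<^sub>R X x" using YX eventually_nhds_x_imp_x by blast
  have "((\<lambda>y. f y *\<^sub>R X y) has_derivative (\<lambda>y. f x *\<^sub>R X' y + f' y *\<^sub>R X x)) (at x)"
    by (rule has_derivative_scaleR[OF f X])
  hence "(Y has_derivative (\<lambda>y. f x *\<^sub>R X' y + f' y *\<^sub>R X x)) (at x)"
    by (rule has_derivative_transform_eventually)
      (use YX in \<open>auto simp: eventually_at_filter Yx elim: eventually_mono\<close>)
  hence Y': "Y' = (\<lambda>y. f x *\<^sub>R X' y + f' y *\<^sub>R X x)"
    using Y has_derivative_unique by blast
  \<comment> \<open>This is \<open>X x\<close> with its index lowered; by symmetry of
    \<open>h x\<close> it represents \<open>X x\<close> in either slot of the metric.\<close>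
  define \<xi> where "\<xi> = h x *v X x"
  have sy: "X x \<bullet> (h x *v z) = \<xi> \<bullet> z" for z
    by (metis \<xi>_def dot_lmul_matrix sym vector_transpose_matrix)
  have *: "f' y * (\<xi> \<bullet> z) + f' z * (\<xi> \<bullet> y) = 0" for y z
  proof -
    have "0 = y \<bullet> (H (Y x) *v z) + Y' y \<bullet> (h x *v z) + y \<bullet> (h x *v Y' z)"
      using KY by simp
    also have "\<dots> = f x * (y \<bullet> (H (X x) *v z) + X' y \<bullet> (h x *v z) + y \<bullet> (h x *v X' z))
        + f' y * (X x \<bullet> (h x *v z)) + f' z * (y \<bullet> \<xi>)"
      unfolding Y' Yx linear_scale[OF H] \<xi>_def
      by (simp add: algebra_simps inner_simps matrix_vector_right_distrib
          bounded_bilinear.scaleR_left[OF bounded_bilinear_matrix_vector_mult]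
          bounded_bilinear.scaleR_right[OF bounded_bilinear_matrix_vector_mult])
    finally show ?thesis using KX by (simp add: sy inner_commute)
  qed
  \<comment> \<open>The Euclidean product of the coordinate space is positive definite, so
    \<open>\<xi> \<bullet> \<xi>\<close> is nonzero even if \<open>X x\<close> is null for the
    metric. Testing with \<open>y = z = \<xi>\<close> gives \<open>f' \<xi> = 0\<close>, and then
    \<open>z = \<xi>\<close> with arbitrary \<open>y\<close> gives \<open>f' y = 0\<close>.\<close>
  have "\<xi> \<bullet> \<xi> \<noteq> 0" using nz by (simp add: \<xi>_def)
  moreover from this have "f' \<xi> = 0" using *[of \<xi> \<xi>] by simp
  ultimately show ?thesis using *[of _ \<xi>] by auto
qed

section \<open>Nondegeneracy, ranks and partial derivatives\<close>

text \<open>In the frame \<open>E\<close> the form is diagonal with entries -1 and 1, so it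
  annihilates only the zero vector.\<close>

lemma lorentz_form_nondegenerate:
  assumes "lorentz_form G" "G *v x = 0"
  shows "x = 0"
proof -
  obtain E where E: "invertible E" "transpose E ** G ** E = minkowski"
    using assms(1) unfolding lorentz_form_def by blast
  then obtain F where F: "E ** F = mat 1" unfolding invertible_def by blast
  define y where "y = F *v x"
  have x: "x = E *v y" by (simp add: y_def matrix_vector_mul_assoc F)
  have "minkowski *v y = transpose E *v (G *v x)"
    unfolding x E(2)[symmetric] by (simp add: matrix_vector_mul_assoc matrix_mul_assoc)
  also have "\<dots> = 0" by (simp add: assms(2))
  finally have m: "minkowski *v y = 0" .
  have "y $ i = 0" for i
  proof -
    have "(minkowski *v y) $ i = (\<Sum>j\<in>UNIV. if j = i then (if i = 1 then - 1 else 1) * y $ j else 0)"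
      unfolding minkowski_def matrix_vector_mult_def vec_lambda_beta by (rule sum.cong) auto
    also have "\<dots> = (if i = 1 then - 1 else 1) * y $ i" by simp
    finally show ?thesis using m by (simp split: if_splits)
  qed
  hence "y = 0" by (simp add: vec_eq_iff)
  thus ?thesis by (simp add: x)
qed

text \<open>Extend the kernel vector \<open>v\<close> to a basis: the images of the other basis
  vectors already span the range.\<close>

lemma dim_range_less:
  fixes L :: "'a::euclidean_space \<Rightarrow> 'b::euclidean_space"
  assumes "linear L" "v \<noteq> 0" "L v = 0"
  shows "dim (range L) < DIM('a)"
proof -
  obtain B where B: "{v} \<subseteq> B" "independent B" "UNIV \<subseteq> span B"
    using maximal_independent_subset_extend[of "{v}" UNIV] assms(2) by auto
  have fin: "finite B" using B(2) independent_imp_finite by blast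
  have "range L \<subseteq> L ` span B" using B(3) by auto
  also have "\<dots> = span (L ` B)" using linear_span_image[OF assms(1)] by simp
  also have "L ` B = insert 0 (L ` (B - {v}))" using B(1) assms(3) by auto
  also have "span (insert 0 (L ` (B - {v}))) = span (L ` (B - {v}))" by simp
  finally have "dim (range L) \<le> card (L ` (B - {v}))"
    using fin by (intro dim_le_card) auto
  also have "\<dots> \<le> card (B - {v})" using fin by (intro card_image_le) auto
  also have "\<dots> < card B" using fin B(1) by (intro psubset_card_mono) auto
  also have "\<dots> \<le> DIM('a)" using B(2) independent_bound by blast
  finally show ?thesis .
qed

text \<open>Otherwise \<open>L v\<close> and \<open>L w\<close> would be two independent vectors in
  a range of dimension at most 1.\<close>

lemma dim_le_1_proportional:
  fixes L :: "'a::euclidean_space \<Rightarrow> 'b::euclidean_space"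
  assumes "dim (range L) \<le> 1" "L w \<noteq> 0"
  obtains c where "L v = c *\<^sub>R L w"
proof (cases "L v \<in> span {L w}")
  case True
  thus thesis using that by (auto simp: span_singleton)
next
  case False
  hence ind: "independent {L v, L w}"
    using assms(2) by (simp add: independent_insert)
  have "L v \<noteq> L w" using False span_base by fastforce
  hence "card {L v, L w} = 2" by simp
  moreover have "card {L v, L w} \<le> dim (range L)"
    using ind by (intro independent_card_le_dim) auto
  ultimately show thesis using assms(1) by simp
qed

lemma has_derivative_partial:
  assumes "(f has_derivative f') (at (a, x))"
  shows "((\<lambda>x. f (a, x)) has_derivative (\<lambda>y. f' (0, y))) (at x)"
    and "((\<lambda>a. f (a, x)) has_derivative (\<lambda>b. f' (b, 0))) (at a)"
proof -
  have "((\<lambda>x. (a, x)) has_derivative (\<lambda>y. (0, y))) (at x)"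
    by (intro has_derivative_Pair has_derivative_const has_derivative_ident)
  from has_derivative_compose[OF this assms]
  show "((\<lambda>x. f (a, x)) has_derivative (\<lambda>y. f' (0, y))) (at x)" .
  have "((\<lambda>a. (a, x)) has_derivative (\<lambda>b. (b, 0))) (at a)"
    by (intro has_derivative_Pair has_derivative_const has_derivative_ident)
  from has_derivative_compose[OF this assms]
  show "((\<lambda>a. f (a, x)) has_derivative (\<lambda>b. f' (b, 0))) (at a)" .
qed

section \<open>Generators of an isometric action in a chart\<close>

text \<open>\<open>\<Phi> (a, x)\<close> is the action in the coordinates of a chart, \<open>\<Omega>\<close> the open set of those \<open>(a, x)\<close> for
  which it is defined and does not leave the chart, and \<open>h\<close> the matrix of the metric.\<close>

locale isometric_action_in_chart =
  fixes G :: "'r::finite local_group"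
    and \<Omega> :: "((real^'r) \<times> (real^'n::finite)) set"
    and \<Phi> :: "(real^'r) \<times> (real^'n) \<Rightarrow> real^'n"
    and h :: "real^'n \<Rightarrow> real^'n^'n"
  assumes open_domain: "open \<Omega>"
    and smooth: "smooth_on \<Omega> \<Phi>"
    and action_zero: "(0, x) \<in> \<Omega> \<Longrightarrow> \<Phi> (0, x) = x"
    and action_gmult: "\<lbrakk>(b, x) \<in> \<Omega>; (a, \<Phi> (b, x)) \<in> \<Omega>; (gmult G a b, x) \<in> \<Omega>\<rbrakk>
      \<Longrightarrow> \<Phi> (a, \<Phi> (b, x)) = \<Phi> (gmult G a b, x)"
    and metric_differentiable: "(0, x) \<in> \<Omega> \<Longrightarrow> h differentiable (at x)"
    and metric_symmetric: "(0, x) \<in> \<Omega> \<Longrightarrow> transpose (h x) = h x"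
    and metric_nondegenerate: "\<lbrakk>(0, x) \<in> \<Omega>; h x *v y = 0\<rbrakk> \<Longrightarrow> y = 0"
    and isometry: "(a, x) \<in> \<Omega> \<Longrightarrow>
      y \<bullet> (h x *v z) = frechet_derivative \<Phi> (at (a, x)) (0, y) \<bullet>
        (h (\<Phi> (a, x)) *v frechet_derivative \<Phi> (at (a, x)) (0, z))"
begin

text \<open>The fundamental vector field of the action belonging to the Lie algebra element
  \<open>w\<close>, in coordinates: the velocity at the identity in the parameter direction
  \<open>w\<close>.\<close>

definition generator :: "real^'r \<Rightarrow> real^'n \<Rightarrow> real^'n" where
  "generator w x = frechet_derivative \<Phi> (at (0, x)) (w, 0)"

lemma eventually_domain:
  assumes "(a, x) \<in> \<Omega>"
  shows "\<forall>\<^sub>F y in nhds x. (a, y) \<in> \<Omega>"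
proof -
  have "((\<lambda>y. (a, y)) \<longlongrightarrow> (a, x)) (nhds x)"
    by (intro tendsto_intros filterlim_ident)
  thus ?thesis using topological_tendstoD[OF _ open_domain assms] by blast
qed

lemma action_has_derivative:
  "p \<in> \<Omega> \<Longrightarrow> (\<Phi> has_derivative frechet_derivative \<Phi> (at p)) (at p)"
  by (rule smooth_on_imp_has_derivative[OF smooth])

lemma linear_generator: "(0, x) \<in> \<Omega> \<Longrightarrow> linear (\<lambda>w. generator w x)"
  unfolding generator_def
  using has_derivative_partial(2)[OF action_has_derivative, of 0 x] has_derivative_linear by blast

text \<open>The derivative is a mixed second derivative of \<open>\<Phi>\<close>. By symmetry it is
  written as the parameter derivative of the spatial differential, the form that appears when the
  isometry equation is differentiated in the group parameter.\<close>

lemma generator_has_derivative: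
  assumes "(0, x) \<in> \<Omega>"
  shows "(generator w has_derivative (\<lambda>y. frechet_derivative
    (\<lambda>p. frechet_derivative \<Phi> (at p) (0, y)) (at (0, x)) (w, 0))) (at x)"
proof -
  have "(generator w has_derivative (\<lambda>y. frechet_derivative
    (\<lambda>p. frechet_derivative \<Phi> (at p) (w, 0)) (at (0, x)) (0, y))) (at x)"
    unfolding generator_def
    by (rule has_derivative_partial[OF smooth_on_imp_has_derivative
          [OF smooth_on_frechet_derivative[OF smooth] assms]])
  thus ?thesis
    by (simp only: symmetric_frechet_derivative[OF open_domain assms smooth, of "(w, 0)"])
qed

lemma frechet_derivative_action_zero:
  assumes "(0, x) \<in> \<Omega>"
  shows "frechet_derivative \<Phi> (at (0, x)) (0, y) = y"
proof -
  have "((\<lambda>x. \<Phi> (0, x)) has_derivative (\<lambda>y. y)) (at x)"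
    by (rule has_derivative_transform_eventually[OF has_derivative_ident])
      (use eventually_domain[OF assms] in
        \<open>auto simp: eventually_at_filter action_zero assms elim: eventually_mono\<close>)
  from has_derivative_unique[OF this has_derivative_partial(1)[OF action_has_derivative[OF assms]]]
  show ?thesis by metis
qed

text \<open>In the isometry equation the left side does not depend on \<open>a\<close>, so the
  derivative of the right side at \<open>a = 0\<close> in the direction \<open>w\<close> vanishes.
  Spelled out by the product rule, this is the vanishing of the Lie derivative of the metric along
  the generator.\<close>

lemma generator_Killing:
  assumes x: "(0, x) \<in> \<Omega>" and X': "(generator w has_derivative X') (at x)"
  shows "y \<bullet> (frechet_derivative h (at x) (generator w x) *v z)
    + X' y \<bullet> (h x *v z) + y \<bullet> (h x *v X' z) = 0"
proof -
  define F where "F = (\<lambda>y p. frechet_derivative \<Phi> (at p) (0::real^'r, y::real^'n))"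
  have F: "((\<lambda>a. F y (a, x)) has_derivative
      (\<lambda>b. frechet_derivative (F y) (at (0, x)) (b, 0))) (at 0)" for y
    unfolding F_def
    by (rule has_derivative_partial[OF smooth_on_imp_has_derivative
          [OF smooth_on_frechet_derivative[OF smooth] x]])
  have X'_eq: "X' y = frechet_derivative (F y) (at (0, x)) (w, 0)" for y
    using has_derivative_unique[OF X' generator_has_derivative[OF x]] unfolding F_def by metis
  have F0: "F y (0, x) = y" for y
    unfolding F_def by (rule frechet_derivative_action_zero[OF x])
  have "(h has_derivative frechet_derivative h (at x)) (at (\<Phi> (0, x)))"
    using metric_differentiable[OF x] frechet_derivative_works action_zero[OF x] by metis
  from has_derivative_compose[OF has_derivative_partial(2)[OF action_has_derivative[OF x]] this]
  have H: "((\<lambda>a. h (\<Phi> (a, x))) has_derivative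
      (\<lambda>b. frechet_derivative h (at x) (generator b x))) (at 0)"
    unfolding generator_def .
  \<comment> \<open>Product rule at \<open>a = 0\<close>, where the spatial differential is the
    identity (\<open>F0\<close>) and \<open>\<Phi> (0, x) = x\<close>.\<close>
  have D: "((\<lambda>a. F y (a, x) \<bullet> (h (\<Phi> (a, x)) *v F z (a, x))) has_derivative
      (\<lambda>b. y \<bullet> (h x *v frechet_derivative (F z) (at (0, x)) (b, 0)
            + frechet_derivative h (at x) (generator b x) *v z)
        + frechet_derivative (F y) (at (0, x)) (b, 0) \<bullet> (h x *v z))) (at 0)"
    using has_derivative_inner[OF F[of y]
        bounded_bilinear.FDERIV[OF bounded_bilinear_matrix_vector_mult H F[of z]]]
    by (simp add: F0 action_zero[OF x])
  have "((\<lambda>a. (a, x)) \<longlongrightarrow> (0, x)) (nhds 0)"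
    by (intro tendsto_intros filterlim_ident)
  hence "\<forall>\<^sub>F a in nhds 0. (a, x) \<in> \<Omega>"
    using topological_tendstoD[OF _ open_domain x] by blast
  hence "\<forall>\<^sub>F a in nhds 0. y \<bullet> (h x *v z) = F y (a, x) \<bullet> (h (\<Phi> (a, x)) *v F z (a, x))"
    by eventually_elim (simp add: F_def isometry)
  hence "((\<lambda>a. F y (a, x) \<bullet> (h (\<Phi> (a, x)) *v F z (a, x))) has_derivative (\<lambda>b. 0)) (at 0)"
    by (intro has_derivative_transform_eventually[OF has_derivative_const])
      (auto simp: eventually_at_filter F0 action_zero[OF x] elim: eventually_mono)
  from fun_cong[OF has_derivative_unique[OF this D], of w] show ?thesis
    by (simp add: X'_eq inner_right_distrib)
qed

section \<open>One-parameter subgroups and the isotropy representation\<close>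

text \<open>By the chain rule, \<open>generator v x\<close> is the velocity at \<open>t = 0\<close>
  of the curve \<open>\<Phi> (\<gamma> t, x)\<close>, which is constant.\<close>

lemma generator_eq_0_if_isotropy:
  assumes "\<epsilon> > 0" "(\<gamma> has_vector_derivative v) (at 0)" "\<gamma> 0 = 0"
    and fixes_x: "\<And>t. \<bar>t\<bar> < \<epsilon> \<Longrightarrow> (\<gamma> t, x) \<in> \<Omega> \<and> \<Phi> (\<gamma> t, x) = x"
  shows "generator v x = 0"
proof -
  have x: "(0, x) \<in> \<Omega>" using fixes_x[of 0] assms(1,3) by simp
  have D: "((\<lambda>a. \<Phi> (a, x)) has_derivative (\<lambda>b. generator b x)) (at (\<gamma> 0))"
    unfolding generator_def assms(3) by (rule has_derivative_partial(2)[OF action_has_derivative[OF x]])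
  have "((\<lambda>t. \<Phi> (\<gamma> t, x)) has_derivative (\<lambda>r. generator (r *\<^sub>R v) x)) (at 0)"
    by (rule has_derivative_compose[OF assms(2)[unfolded has_vector_derivative_def] D])
  moreover have "((\<lambda>t. \<Phi> (\<gamma> t, x)) has_derivative (\<lambda>r. 0)) (at 0)"
  proof (rule has_derivative_transform_within_open[OF has_derivative_const[of x]])
    show "open {-\<epsilon><..<\<epsilon>}" by simp
  qed (use assms(1) fixes_x in auto)
  ultimately have "(\<lambda>r. generator (r *\<^sub>R v) x) = (\<lambda>r. 0)"
    by (rule has_derivative_unique)
  from fun_cong[OF this, of 1] show ?thesis by simp
qed

text \<open>By the subgroup law the curve \<open>\<Phi> (\<gamma> t, x)\<close> has at each time the
  velocity given by \<open>generator v\<close> at its current point. As long as the curve stays in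
  \<open>U\<close> this velocity is zero, so the curve stays at \<open>x\<close>.\<close>

lemma one_param_subgroup_acts_trivially:
  assumes \<gamma>: "one_param_subgroup G \<epsilon> \<gamma>" "(\<gamma> has_vector_derivative v) (at 0)"
    and U: "open U" "x\<^sub>0 \<in> U" "\<And>x. x \<in> U \<Longrightarrow> (0, x) \<in> \<Omega> \<and> generator v x = 0"
  obtains \<delta> \<rho> where "\<delta> > 0" "\<rho> > 0"
    "\<And>t x. \<lbrakk>\<bar>t\<bar> < \<delta>; dist x x\<^sub>0 < \<rho>\<rbrakk> \<Longrightarrow> (\<gamma> t, x) \<in> \<Omega> \<and> \<Phi> (\<gamma> t, x) = x"
proof -
  have \<epsilon>: "\<epsilon> > 0" and \<gamma>0: "\<gamma> 0 = 0"
    and add: "\<And>s t. \<lbrakk>\<bar>s\<bar> < \<epsilon>; \<bar>t\<bar> < \<epsilon>; \<bar>s + t\<bar> < \<epsilon>\<rbrakk> \<Longrightarrow> \<gamma> (s + t) = gmult G (\<gamma> s) (\<gamma> t)"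
    using \<gamma>(1) unfolding one_param_subgroup_def by auto
  have "isCont \<gamma> 0" using \<gamma>(2) has_vector_derivative_continuous by blast
  hence cont: "(\<gamma> \<longlongrightarrow> 0) (nhds 0)"
    using \<gamma>0 isCont_imp_tendsto_nhds by fastforce
  have lim: "((\<lambda>p. (\<gamma> (fst p), snd p)) \<longlongrightarrow> (0, x)) (nhds (0, x))" for x :: "real^'n"
    using tendsto_fst[OF filterlim_ident[of "nhds (0, x)"]]
      tendsto_snd[OF filterlim_ident[of "nhds (0::real, x)"]]
    by (intro tendsto_Pair filterlim_compose[OF cont]) auto
  have x0: "(0, x\<^sub>0) \<in> \<Omega>" using U by blast
  have "isCont \<Phi> (0, x\<^sub>0)"
    using action_has_derivative[OF x0] has_derivative_continuous by blast
  hence "(\<Phi> \<longlongrightarrow> x\<^sub>0) (nhds (0, x\<^sub>0))"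
    using action_zero[OF x0] isCont_imp_tendsto_nhds by fastforce
  hence "((\<lambda>p. \<Phi> (\<gamma> (fst p), snd p)) \<longlongrightarrow> x\<^sub>0) (nhds (0, x\<^sub>0))"
    using filterlim_compose[OF _ lim] by blast
  \<comment> \<open>Joint continuity at \<open>(0, x\<^sub>0)\<close> gives a product neighbourhood
    on which the action is defined in the chart and the moved point remains in
    \<open>U\<close>.\<close>
  from topological_tendstoD[OF lim open_domain x0] topological_tendstoD[OF this U(1,2)]
  have "\<forall>\<^sub>F p in nhds 0 \<times>\<^sub>F nhds x\<^sub>0. (\<gamma> (fst p), snd p) \<in> \<Omega> \<and> \<Phi> (\<gamma> (fst p), snd p) \<in> U"
    unfolding nhds_prod by (rule eventually_conj)
  then obtain P Q where PQ: "\<forall>\<^sub>F t in nhds 0. P t" "\<forall>\<^sub>F x in nhds x\<^sub>0. Q x"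
    "\<And>t x. P t \<Longrightarrow> Q x \<Longrightarrow> (\<gamma> t, x) \<in> \<Omega> \<and> \<Phi> (\<gamma> t, x) \<in> U"
    unfolding eventually_prod_filter by auto
  obtain \<delta>' where \<delta>': "\<delta>' > 0" "\<And>t. \<bar>t\<bar> < \<delta>' \<Longrightarrow> P t"
    using PQ(1) unfolding eventually_nhds_metric dist_real_def by auto
  obtain \<rho> where \<rho>: "\<rho> > 0" "\<And>x. dist x x\<^sub>0 < \<rho> \<Longrightarrow> Q x"
    using PQ(2) unfolding eventually_nhds_metric by auto
  define \<delta> where "\<delta> = min \<delta>' \<epsilon>"
  have \<delta>: "\<delta> > 0" "\<delta> \<le> \<epsilon>" using \<delta>'(1) \<epsilon> by (auto simp: \<delta>_def)
  have dom: "(\<gamma> t, x) \<in> \<Omega>" "\<Phi> (\<gamma> t, x) \<in> U" if "\<bar>t\<bar> < \<delta>" "dist x x\<^sub>0 < \<rho>" for t x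
    using PQ(3)[OF \<delta>'(2) \<rho>(2)] that by (auto simp: \<delta>_def)
  have fixed: "\<Phi> (\<gamma> t, x) = x" if t: "\<bar>t\<bar> < \<delta>" and x: "dist x x\<^sub>0 < \<rho>" for t x
  proof -
    have "((\<lambda>t. \<Phi> (\<gamma> t, x)) has_derivative (\<lambda>r. 0)) (at t)" if t: "\<bar>t\<bar> < \<delta>" for t
    proof -
      \<comment> \<open>Restarting at the current point \<open>y\<close> turns the derivative at
        time \<open>t\<close> into one at time 0, where \<open>generator v y = 0\<close>
        applies.\<close>
      define y where "y = \<Phi> (\<gamma> t, x)"
      have y: "(0, y) \<in> \<Omega>" "generator v y = 0"
        using U(3) dom(2)[OF t x] by (auto simp: y_def)
      have D: "((\<lambda>a. \<Phi> (a, y)) has_derivative (\<lambda>b. generator b y)) (at (\<gamma> 0))"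
        unfolding generator_def \<gamma>0
        by (rule has_derivative_partial(2)[OF action_has_derivative[OF y(1)]])
      have "((\<lambda>s. \<Phi> (\<gamma> s, y)) has_derivative (\<lambda>r. generator (r *\<^sub>R v) y)) (at 0)"
        by (rule has_derivative_compose[OF \<gamma>(2)[unfolded has_vector_derivative_def] D])
      \<comment> \<open>The base point 0 is written \<open>t - t\<close> to match the shift
        \<open>s - t\<close> at \<open>s = t\<close>.\<close>
      hence "((\<lambda>s. \<Phi> (\<gamma> s, y)) has_derivative (\<lambda>r. 0)) (at (t - t))"
        using linear_scale[OF linear_generator[OF y(1)]] y(2) by simp
      hence 1: "((\<lambda>s. \<Phi> (\<gamma> (s - t), y)) has_derivative (\<lambda>r. 0)) (at t)"
        by (rule has_derivative_compose[rotated, where f = "\<lambda>s. s - t"])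
          (auto intro!: derivative_eq_intros)
      have "((\<lambda>s. (\<gamma> s, y)) \<longlongrightarrow> (0, y)) (nhds 0)" by (intro tendsto_intros cont)
      hence "\<forall>\<^sub>F s in nhds 0. (\<gamma> s, y) \<in> \<Omega>"
        using topological_tendstoD[OF _ open_domain y(1)] by blast
      moreover have "((\<lambda>s. s - t) \<longlongrightarrow> t - t) (nhds t)" by (intro tendsto_intros filterlim_ident)
      hence "((\<lambda>s. s - t) \<longlongrightarrow> 0) (nhds t)" by simp
      ultimately have "\<forall>\<^sub>F s in nhds t. (\<gamma> (s - t), y) \<in> \<Omega>"
        by (rule eventually_compose_filterlim)
      moreover have "\<forall>\<^sub>F s in nhds t. s \<in> {-\<delta><..<\<delta>}"
        using t by (intro eventually_nhds_in_open) auto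
      moreover have "\<forall>\<^sub>F s in nhds t. s \<in> {t - \<epsilon><..<t + \<epsilon>}"
        using \<epsilon> by (intro eventually_nhds_in_open) auto
      \<comment> \<open>The three conditions on \<open>s\<close> provide what the local laws
        require: \<open>\<gamma> (s - t)\<close> acts on \<open>y\<close> and
        \<open>\<gamma> s\<close> acts on \<open>x\<close> within \<open>\<Omega>\<close>, and the
        parameters \<open>s\<close>, \<open>t\<close> and \<open>s - t\<close> are all less than
        \<open>\<epsilon>\<close> in absolute value.\<close>
      ultimately have "\<forall>\<^sub>F s in nhds t. \<Phi> (\<gamma> (s - t), y) = \<Phi> (\<gamma> s, x)"
      proof eventually_elim
        case (elim s)
        have s: "\<gamma> s = gmult G (\<gamma> (s - t)) (\<gamma> t)"
          using add[of "s - t" t] elim t \<delta> by auto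
        show ?case
          using action_gmult[of "\<gamma> t" x "\<gamma> (s - t)"] dom(1)[OF t x] dom(1)[of s, OF _ x] elim
          by (auto simp: y_def s)
      qed
      hence 2: "\<forall>\<^sub>F s in at t. \<Phi> (\<gamma> (s - t), y) = \<Phi> (\<gamma> s, x)"
        by (auto simp: eventually_at_filter elim: eventually_mono)
      have 3: "\<Phi> (\<gamma> (t - t), y) = \<Phi> (\<gamma> t, x)"
        using action_zero[OF y(1)] \<gamma>0 by (simp add: y_def)
      show ?thesis
        by (rule has_derivative_transform_eventually[OF 1 2 3]) simp
    qed
    hence "((\<lambda>t. \<Phi> (\<gamma> t, x)) has_derivative (\<lambda>r. 0)) (at t within {-\<delta><..<\<delta>})"
      if "t \<in> {-\<delta><..<\<delta>}" for t
      using that by (auto intro: has_derivative_at_withinI)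
    from has_derivative_zero_unique[OF _ this, of t 0]
    have "\<Phi> (\<gamma> t, x) = \<Phi> (\<gamma> 0, x)" using t \<delta> by (auto simp: abs_less_iff)
    thus ?thesis using action_zero dom(1)[of 0 x] x \<delta> \<gamma>0 by simp
  qed
  show thesis using that[OF \<delta>(1) \<rho>(1)] dom fixed by blast
qed

text \<open>Chain rule at \<open>x\<close> for the composition law, which holds on a neighbourhood
  of \<open>x\<close> because \<open>\<Omega>\<close> is open. Since both elements fix
  \<open>x\<close>, all differentials are taken at the same point, and the isotropy representation
  is multiplicative.\<close>

lemma isotropy_representation_add:
  assumes st: "(a, x) \<in> \<Omega>" "\<Phi> (a, x) = x" "(b, x) \<in> \<Omega>" "\<Phi> (b, x) = x"
    "(gmult G a b, x) \<in> \<Omega>"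
  shows "frechet_derivative \<Phi> (at (gmult G a b, x)) (0, y)
    = frechet_derivative \<Phi> (at (a, x)) (0, frechet_derivative \<Phi> (at (b, x)) (0, y))"
proof -
  have "((\<lambda>y. (a, \<Phi> (b, y))) \<longlongrightarrow> (a, \<Phi> (b, x))) (nhds x)"
  proof (intro tendsto_intros)
    have "isCont (\<lambda>y. \<Phi> (b, y)) x"
      using has_derivative_partial(1)[OF action_has_derivative[OF st(3)]]
        has_derivative_continuous by blast
    thus "((\<lambda>y. \<Phi> (b, y)) \<longlongrightarrow> \<Phi> (b, x)) (nhds x)"
      by (rule isCont_imp_tendsto_nhds)
  qed
  hence "\<forall>\<^sub>F y in nhds x. (a, \<Phi> (b, y)) \<in> \<Omega>"
    using topological_tendstoD[OF _ open_domain] st by metis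
  with eventually_domain[OF st(3)] eventually_domain[OF st(5)]
  have "\<forall>\<^sub>F y in nhds x. \<Phi> (a, \<Phi> (b, y)) = \<Phi> (gmult G a b, y)"
    by eventually_elim (rule action_gmult)
  hence ev: "\<forall>\<^sub>F y in at x. \<Phi> (a, \<Phi> (b, y)) = \<Phi> (gmult G a b, y)"
    "\<Phi> (a, \<Phi> (b, x)) = \<Phi> (gmult G a b, x)"
    using eventually_nhds_x_imp_x[of _ x] by (auto simp: eventually_at_filter elim: eventually_mono)
  have a: "((\<lambda>y. \<Phi> (a, y)) has_derivative (\<lambda>y. frechet_derivative \<Phi> (at (a, x)) (0, y))) (at (\<Phi> (b, x)))"
    unfolding st(4) by (rule has_derivative_partial(1)[OF action_has_derivative[OF st(1)]])
  have "((\<lambda>y. \<Phi> (gmult G a b, y)) has_derivative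
      (\<lambda>y. frechet_derivative \<Phi> (at (a, x)) (0, frechet_derivative \<Phi> (at (b, x)) (0, y)))) (at x)"
    by (rule has_derivative_transform_eventually[OF has_derivative_compose
          [OF has_derivative_partial(1)[OF action_has_derivative[OF st(3)]] a] ev]) simp
  from has_derivative_unique[OF has_derivative_partial(1)[OF action_has_derivative[OF st(5)]] this]
  show ?thesis by metis
qed

text \<open>The isotropy representation \<open>T\<close> along \<open>\<gamma>\<close> satisfies \<open>T t = (T (t / n)) ^ n\<close>.\<close>

lemma isotropy_representation_trivial:
  assumes \<gamma>: "one_param_subgroup G \<epsilon> \<gamma>"
    and fixes_x: "\<And>t. \<bar>t\<bar> < \<epsilon> \<Longrightarrow> (\<gamma> t, x) \<in> \<Omega> \<and> \<Phi> (\<gamma> t, x) = x"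
    and "\<delta> > 0" and small: "\<And>t y. \<bar>t\<bar> < \<delta> \<Longrightarrow> frechet_derivative \<Phi> (at (\<gamma> t, x)) (0, y) = y"
    and t: "\<bar>t\<bar> < \<epsilon>"
  shows "frechet_derivative \<Phi> (at (\<gamma> t, x)) (0, y) = y"
proof -
  obtain n where n: "\<bar>t\<bar> / \<delta> < real n" using reals_Archimedean2 by blast
  have npos: "real n > 0" using n assms(3) by (smt (verit) divide_nonneg_pos)
  define s where "s = t / n"
  have s: "\<bar>s\<bar> < \<delta>" "t = real n * s"
    using n npos assms(3) by (auto simp: s_def field_simps)
  \<comment> \<open>The group law is only local, so every intermediate time \<open>k s\<close> must
    remain in the interval of definition of \<open>\<gamma>\<close>.\<close>
  have le: "\<bar>real k * s\<bar> < \<epsilon>" if "k \<le> n" for k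
  proof -
    have "\<bar>real k * s\<bar> \<le> \<bar>real n * s\<bar>"
      unfolding abs_mult using that by (intro mult_right_mono) auto
    thus ?thesis using t s(2) by simp
  qed
  have "k \<le> n \<Longrightarrow> frechet_derivative \<Phi> (at (\<gamma> (real k * s), x)) (0, y) = y" for k
  proof (induction k)
    case 0
    show ?case using small[of 0] assms(3) by simp
  next
    case (Suc k)
    have 1: "\<bar>s\<bar> < \<epsilon>" using le[of 1] npos by simp
    have 2: "\<bar>real k * s\<bar> < \<epsilon>" "\<bar>s + real k * s\<bar> < \<epsilon>"
      using le[of k] le[of "Suc k"] Suc.prems by (auto simp: algebra_simps)
    have g: "\<gamma> (s + real k * s) = gmult G (\<gamma> s) (\<gamma> (real k * s))"
      using \<gamma> 1 2 unfolding one_param_subgroup_def by blast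
    have "frechet_derivative \<Phi> (at (\<gamma> (s + real k * s), x)) (0, y) = y"
      unfolding g
      using isotropy_representation_add[of "\<gamma> s" x "\<gamma> (real k * s)" y]
        fixes_x[OF 1] fixes_x[OF 2(1)] fixes_x[OF 2(2)] Suc small[OF s(1)]
      by (simp add: g)
    thus ?case by (simp add: algebra_simps)
  qed
  thus ?thesis using s(2) by blast
qed

section \<open>Orbits of dimension at most one\<close>

text \<open>If all generators vanish at \<open>x\<^sub>0\<close>, then \<open>q = 0\<close> and they
  vanish throughout. Otherwise some \<open>generator w\<close> is nonzero near
  \<open>x\<^sub>0\<close>, and \<open>generator v\<close> is a multiple of it; the factor is
  constant by \<open>proportional_Killing_fields\<close> and is 0 at
  \<open>x\<^sub>0\<close>.\<close>

lemma generator_vanishes_near: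
  assumes x0: "(0, x\<^sub>0) \<in> \<Omega>"
    and dims: "\<And>x. (0, x) \<in> \<Omega> \<Longrightarrow> dim (range (\<lambda>w. generator w x)) = q" and "q \<le> 1"
    and v: "generator v x\<^sub>0 = 0"
  obtains U where "open U" "x\<^sub>0 \<in> U" "\<And>x. x \<in> U \<Longrightarrow> (0, x) \<in> \<Omega> \<and> generator v x = 0"
proof (cases "\<forall>w. generator w x\<^sub>0 = 0")
  case True
  hence "range (\<lambda>w. generator w x\<^sub>0) = {0}" by auto
  hence q: "q = 0" using dims[OF x0] by simp
  have "generator v x = 0" if "(0, x) \<in> \<Omega>" for x
    using dims[OF that] unfolding q dim_eq_0 by auto
  moreover obtain U where "open U" "x\<^sub>0 \<in> U" "\<forall>x\<in>U. (0, x) \<in> \<Omega>"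
    using eventually_domain[OF x0] unfolding eventually_nhds by blast
  ultimately show thesis using that by blast
next
  case False
  then obtain w where w: "generator w x\<^sub>0 \<noteq> 0" by blast
  have "isCont (generator w) x\<^sub>0"
    using generator_has_derivative[OF x0] has_derivative_continuous by blast
  hence "(generator w \<longlongrightarrow> generator w x\<^sub>0) (nhds x\<^sub>0)"
    by (rule isCont_imp_tendsto_nhds)
  hence "\<forall>\<^sub>F x in nhds x\<^sub>0. generator w x \<in> - {0}"
    using w by (intro topological_tendstoD) auto
  hence "\<forall>\<^sub>F x in nhds x\<^sub>0. (0, x) \<in> \<Omega> \<and> generator w x \<noteq> 0"
    using eventually_domain[OF x0] by eventually_elim auto
  then obtain d where d: "d > 0" "\<And>x. x \<in> ball x\<^sub>0 d \<Longrightarrow> (0, x) \<in> \<Omega> \<and> generator w x \<noteq> 0"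
    unfolding eventually_nhds_metric by (auto simp: dist_commute)
  \<comment> \<open>The rank argument yields a factor at each point separately; this quotient is
    that factor in closed form, which makes it visibly differentiable.\<close>
  define f where "f = (\<lambda>x. (generator v x \<bullet> generator w x) / (generator w x \<bullet> generator w x))"
  have f: "generator v x = f x *\<^sub>R generator w x" if x: "x \<in> ball x\<^sub>0 d" for x
  proof -
    obtain c where "generator v x = c *\<^sub>R generator w x"
      using dim_le_1_proportional[of "\<lambda>w. generator w x" w v] dims[of x] d(2)[OF x] assms(3)
      by auto
    thus ?thesis using d(2)[OF x] by (simp add: f_def)
  qed
  have "(f has_derivative (\<lambda>_. 0)) (at x)" if x: "x \<in> ball x\<^sub>0 d" for x
  proof -
    have "f differentiable (at x)"
      unfolding f_def
      using generator_has_derivative[of x] d(2)[OF x]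
      by (intro differentiable_divide differentiable_inner) (auto simp: differentiable_def)
    then obtain f' where f': "(f has_derivative f') (at x)"
      unfolding differentiable_def by blast
    have "\<forall>\<^sub>F y in nhds x. y \<in> ball x\<^sub>0 d"
      using x by (intro eventually_nhds_in_open) auto
    hence ev: "\<forall>\<^sub>F y in nhds x. generator v y = f y *\<^sub>R generator w y"
      by eventually_elim (rule f)
    have x\<Omega>: "(0, x) \<in> \<Omega>" using d(2)[OF x] by blast
    have lin: "linear (frechet_derivative h (at x))"
      using metric_differentiable[OF x\<Omega>] linear_frechet_derivative by blast
    obtain W' where gw: "(generator w has_derivative W') (at x)"
      using generator_has_derivative[OF x\<Omega>] by blast
    obtain V' where gv: "(generator v has_derivative V') (at x)"
      using generator_has_derivative[OF x\<Omega>] by blast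
    \<comment> \<open>Nondegeneracy ensures that lowering the index of a nonzero generator does not
      annihilate it, even when the generator is null.\<close>
    have nz: "h x *v generator w x \<noteq> 0"
      using metric_nondegenerate[OF x\<Omega>, of "generator w x"] d(2)[OF x] by auto
    have "f' = (\<lambda>_. 0)"
    proof (rule proportional_Killing_fields[where h = h and X = "generator w" and Y = "generator v"
          and f = f and H = "frechet_derivative h (at x)" and X' = W' and Y' = V' and x = x,
          OF gw gv f' ev lin])
      show "y \<bullet> (frechet_derivative h (at x) (generator w x) *v z)
          + W' y \<bullet> (h x *v z) + y \<bullet> (h x *v W' z) = 0" for y z
        using generator_Killing[where y = y and z = z, OF x\<Omega> gw] .
      show "y \<bullet> (frechet_derivative h (at x) (generator v x) *v z)
          + V' y \<bullet> (h x *v z) + y \<bullet> (h x *v V' z) = 0" for y z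
        using generator_Killing[where y = y and z = z, OF x\<Omega> gv] .
      show "transpose (h x) = h x" by (rule metric_symmetric[OF x\<Omega>])
      show "h x *v generator w x \<noteq> 0" by (rule nz)
    qed
    thus ?thesis using f' by simp
  qed
  hence "(f has_derivative (\<lambda>_. 0)) (at x within ball x\<^sub>0 d)" if "x \<in> ball x\<^sub>0 d" for x
    using that by (blast intro: has_derivative_at_withinI)
  hence "f x = f x\<^sub>0" if "x \<in> ball x\<^sub>0 d" for x
    by (rule has_derivative_zero_unique[OF convex_ball]) (use that d(1) in auto)
  moreover have "f x\<^sub>0 = 0" by (simp add: f_def v)
  ultimately have "generator v x = 0" if "x \<in> ball x\<^sub>0 d" for x
    using f[OF that] that by (metis scaleR_zero_left)
  thus thesis using that[of "ball x\<^sub>0 d"] d by auto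
qed

text \<open>The nonzero vector \<open>u\<close> lowers the rank of the orbit map at
  \<open>x\<^sub>0\<close> and so gives \<open>q \<le> 1\<close>. The generator of
  \<open>\<gamma>\<close>, whose initial velocity \<open>v\<close> may differ from \<open>u\<close>,
  then vanishes near \<open>x\<^sub>0\<close>, and small elements of \<open>\<gamma>\<close> act
  there as the identity.\<close>

lemma isotropy_representation_trivial_of_dim_le_2:
  assumes "CARD('r) \<le> 2"
    and dims: "\<And>x. (0, x) \<in> \<Omega> \<Longrightarrow> dim (range (\<lambda>w. generator w x)) = q"
    and u: "u \<noteq> 0" "generator u x\<^sub>0 = 0"
    and \<gamma>: "one_param_subgroup G \<epsilon> \<gamma>"
    and fixes_x: "\<And>t. \<bar>t\<bar> < \<epsilon> \<Longrightarrow> (\<gamma> t, x\<^sub>0) \<in> \<Omega> \<and> \<Phi> (\<gamma> t, x\<^sub>0) = x\<^sub>0"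
    and "\<bar>t\<bar> < \<epsilon>"
  shows "frechet_derivative \<Phi> (at (\<gamma> t, x\<^sub>0)) (0, y) = y"
proof -
  have \<epsilon>: "\<epsilon> > 0" and \<gamma>0: "\<gamma> 0 = 0" and sm: "smooth_on {-\<epsilon><..<\<epsilon>} \<gamma>"
    using \<gamma> unfolding one_param_subgroup_def by auto
  have x0: "(0, x\<^sub>0) \<in> \<Omega>" using fixes_x[of 0] \<epsilon> \<gamma>0 by simp
  have "\<gamma> differentiable (at 0)"
    using smooth_on_imp_differentiable[OF sm] \<epsilon> by simp
  then obtain v where v: "(\<gamma> has_vector_derivative v) (at 0)"
    using vector_derivative_works by blast
  have v0: "generator v x\<^sub>0 = 0"
    by (rule generator_eq_0_if_isotropy[OF \<epsilon> v \<gamma>0 fixes_x])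
  have "q < 2"
    using dim_range_less[OF linear_generator[OF x0] u] dims[OF x0] assms(1) by simp
  then obtain U where U: "open U" "x\<^sub>0 \<in> U" "\<And>x. x \<in> U \<Longrightarrow> (0, x) \<in> \<Omega> \<and> generator v x = 0"
    using generator_vanishes_near[where q = q, OF x0 dims _ v0] by auto
  obtain \<delta> \<rho> where \<delta>: "\<delta> > 0" "\<rho> > 0"
    "\<And>t x. \<lbrakk>\<bar>t\<bar> < \<delta>; dist x x\<^sub>0 < \<rho>\<rbrakk> \<Longrightarrow> (\<gamma> t, x) \<in> \<Omega> \<and> \<Phi> (\<gamma> t, x) = x"
    using one_param_subgroup_acts_trivially[OF \<gamma> v U] by blast
  have "frechet_derivative \<Phi> (at (\<gamma> t, x\<^sub>0)) (0, y) = y" if t: "\<bar>t\<bar> < \<delta>" for t y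
  proof -
    have "(\<gamma> t, x\<^sub>0) \<in> \<Omega>" using \<delta> t by simp
    note 1 = has_derivative_partial(1)[OF action_has_derivative[OF this]]
    have "((\<lambda>x. \<Phi> (\<gamma> t, x)) has_derivative (\<lambda>y. y)) (at x\<^sub>0)"
      by (rule has_derivative_transform_within_open[OF has_derivative_ident open_ball[of x\<^sub>0 \<rho>]])
        (use \<delta> t in \<open>auto simp: dist_commute\<close>)
    from has_derivative_unique[OF 1 this] show ?thesis by metis
  qed
  \<comment> \<open>Multiplicativity extends triviality from \<open>\<bar>t\<bar> < \<delta>\<close>
    to the whole interval of \<open>\<gamma>\<close>.\<close>
  from isotropy_representation_trivial[OF \<gamma> fixes_x \<delta>(1) this assms(7)] show ?thesis .
qed

end

section \<open>Passage from the spacetime to a chart\<close>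

lemma isometric_action_in_chart_of_group_of_motions:
  fixes A :: "'a::{t2_space, second_countable_topology} chart set"
    and G :: "'r::finite local_group"
  assumes A: "spacetime A g" and motions: "group_of_motions A g W G D \<Psi>" and c: "c \<in> A"
  defines "\<Omega> \<equiv> {(a, x). x \<in> coord c ` domain c \<and> (a, coord_inv c x) \<in> D \<and>
      \<Psi> a (coord_inv c x) \<in> domain c}"
    and "\<Phi> \<equiv> (\<lambda>(a, x). coord c (\<Psi> a (coord_inv c x)))"
  shows "isometric_action_in_chart G \<Omega> \<Phi> (\<lambda>x. g c (coord_inv c x))"
proof -
  have chart: "open (domain c)" "open (coord c ` domain c)"
    "homeomorphism (domain c) (coord c ` domain c) (coord c) (coord_inv c)"
    using A c unfolding spacetime_def smooth_atlas_def is_chart_def by blast+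
  have inv: "coord_inv c (coord c P) = P" if "P \<in> domain c" for P
    using chart(3) that by (simp add: homeomorphism_def)
  have cont_inv: "continuous_on (coord c ` domain c) (coord_inv c)"
    using chart(3) by (simp add: homeomorphism_def)
  have inv_dom: "coord_inv c x \<in> domain c" if "x \<in> coord c ` domain c" for x
    using inv that by auto
  have inv2: "coord c (coord_inv c x) = x" if "x \<in> coord c ` domain c" for x
    using inv that by auto
  have ltg: "local_transformation_group A W G D \<Psi>" and iso: "acts_by_isometries A g D \<Psi>"
    using motions unfolding group_of_motions_def by blast+
  have D: "open D" "D \<subseteq> params G \<times> W"
    and contD: "continuous_on D (\<lambda>(a, P). \<Psi> a P)"
    and zero: "\<And>P. P \<in> W \<Longrightarrow> \<Psi> 0 P = P"
    and mult: "\<And>a b P. \<lbrakk>(b, P) \<in> D; (a, \<Psi> b P) \<in> D; (gmult G a b, P) \<in> D\<rbrakk> \<Longrightarrow>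
        \<Psi> a (\<Psi> b P) = \<Psi> (gmult G a b) P"
    using ltg unfolding local_transformation_group_def by blast+
  have smooth: "smooth_on \<Omega> \<Phi>"
    using ltg c unfolding local_transformation_group_def \<Omega>_def \<Phi>_def by blast
  \<comment> \<open>\<open>J\<close> replaces coordinates by points. Openness of
    \<open>\<Omega>\<close> follows by taking preimages twice: of \<open>D\<close> under
    \<open>J\<close>, then of the chart domain under the action composed with
    \<open>J\<close>.\<close>
  define J where "J = (\<lambda>p :: (real^'r) \<times> (real^4). (fst p, coord_inv c (snd p)))"
  have contJ: "continuous_on (UNIV \<times> coord c ` domain c) J"
    unfolding J_def
    by (intro continuous_intros continuous_on_compose2[OF cont_inv]) auto
  have open1: "open ((UNIV \<times> coord c ` domain c) \<inter> J -` D)" (is "open ?\<Omega>1")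
    by (rule continuous_open_preimage[OF contJ]) (auto intro: open_Times chart D)
  have cont2: "continuous_on ?\<Omega>1 (\<lambda>p. (\<lambda>(a, P). \<Psi> a P) (J p))"
    by (rule continuous_on_compose2[OF contD continuous_on_subset[OF contJ]]) auto
  have "open (?\<Omega>1 \<inter> (\<lambda>p. (\<lambda>(a, P). \<Psi> a P) (J p)) -` domain c)"
    by (rule continuous_open_preimage[OF cont2 open1 chart(1)])
  also have "?\<Omega>1 \<inter> (\<lambda>p. (\<lambda>(a, P). \<Psi> a P) (J p)) -` domain c = \<Omega>"
    by (auto simp: \<Omega>_def J_def)
  finally have open_\<Omega>: "open \<Omega>" .
  show ?thesis
  proof
    show "open \<Omega>" "smooth_on \<Omega> \<Phi>" by fact+
  next
    fix x assume "(0, x) \<in> \<Omega>"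
    thus "\<Phi> (0, x) = x"
      using D(2) zero inv2 by (auto simp: \<Omega>_def \<Phi>_def)
  next
    fix a b x assume "(b, x) \<in> \<Omega>" "(a, \<Phi> (b, x)) \<in> \<Omega>" "(gmult G a b, x) \<in> \<Omega>"
    thus "\<Phi> (a, \<Phi> (b, x)) = \<Phi> (gmult G a b, x)"
      using mult inv by (auto simp: \<Omega>_def \<Phi>_def)
  next
    fix x assume "(0, x) \<in> \<Omega>"
    hence x: "x \<in> coord c ` domain c" by (auto simp: \<Omega>_def)
    have "smooth_on (coord c ` domain c) (\<lambda>x. g c (coord_inv c x))"
      using A c unfolding spacetime_def by blast
    thus "(\<lambda>x. g c (coord_inv c x)) differentiable (at x)"
      using x by (rule smooth_on_imp_differentiable)
    show "transpose (g c (coord_inv c x)) = g c (coord_inv c x)"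
      using A c inv_dom[OF x] unfolding spacetime_def by blast
    fix y assume "g c (coord_inv c x) *v y = 0"
    moreover have "lorentz_form (g c (coord_inv c x))"
      using A c inv_dom[OF x] unfolding spacetime_def by blast
    ultimately show "y = 0" using lorentz_form_nondegenerate by blast
  next
    fix a x y z assume ax: "(a, x) \<in> \<Omega>"
    define P where "P = coord_inv c x"
    define T where "T = differential c c (\<Psi> a) P"
    have P: "P \<in> domain c" "(a, P) \<in> D" "\<Psi> a P \<in> domain c" "coord c P = x"
      using ax inv_dom inv2 by (auto simp: \<Omega>_def P_def)
    have "((\<lambda>x. \<Phi> (a, x)) has_derivative (\<lambda>y. frechet_derivative \<Phi> (at (a, x)) (0, y))) (at x)"
      by (rule has_derivative_partial(1)[OF smooth_on_imp_has_derivative[OF smooth ax]])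
    moreover have "(\<lambda>x. \<Phi> (a, x)) = coord c \<circ> \<Psi> a \<circ> coord_inv c"
      by (auto simp: \<Phi>_def)
    ultimately have der: "((coord c \<circ> \<Psi> a \<circ> coord_inv c) has_derivative
        (\<lambda>y. frechet_derivative \<Phi> (at (a, x)) (0, y))) (at x)"
      by simp
    \<comment> \<open>This identifies the matrix \<open>differential\<close> with the spatial part
      of the derivative of \<open>\<Phi>\<close>, so that the tensor equation for isometries becomes
      the one of the locale.\<close>
    have T: "T *v y = frechet_derivative \<Phi> (at (a, x)) (0, y)" for y
      unfolding T_def differential_def P(4) frechet_derivative_at[OF der, symmetric]
      by (rule matrix_works) (use has_derivative_linear[OF der] linear_matrix_vector_mul_eq in blast)
    have "g c P = transpose T ** g c (\<Psi> a P) ** T"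
      using iso c P unfolding acts_by_isometries_def T_def by blast
    hence "y \<bullet> (g c P *v z) = y \<bullet> (transpose T *v (g c (\<Psi> a P) *v (T *v z)))"
      by (simp add: matrix_vector_mul_assoc matrix_mul_assoc)
    also have "\<dots> = (T *v y) \<bullet> (g c (\<Psi> a P) *v (T *v z))"
      by (metis dot_lmul_matrix inner_commute transpose_matrix_vector)
    finally show "y \<bullet> (g c (coord_inv c x) *v z) =
        frechet_derivative \<Phi> (at (a, x)) (0, y) \<bullet>
          (g c (coord_inv c (\<Phi> (a, x))) *v frechet_derivative \<Phi> (at (a, x)) (0, z))"
      using inv[OF P(3)] by (simp add: T \<Phi>_def flip: P_def)
  qed
qed

section \<open>The dimension of the given group\<close>

theorem mainTheorem3:
  fixes A :: "'a::{t2_space, second_countable_topology} chart set"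
    and g :: "'a metric_field"
    and P\<^sub>o :: 'a
  assumes "spacetime A g"
    and "P\<^sub>o \<in> manifold A"
    and "locally_null_rotation_isotropic TYPE('r::finite) A g P\<^sub>o"
  shows "\<exists>W (G :: 'r local_group) D \<Psi>.
           P\<^sub>o \<in> W \<and> group_of_motions A g W G D \<Psi> \<and> multiply_transitive A W G D \<Psi> \<and>
           CARD('r) \<ge> 3"
proof -
  obtain W D \<Psi> and G :: "'r local_group" where P0: "P\<^sub>o \<in> W"
    and motions: "group_of_motions A g W G D \<Psi>"
    and trans: "multiply_transitive A W G D \<Psi>"
    and null: "null_rotation_isotropy A g G D \<Psi> P\<^sub>o"
    using assms(3) unfolding locally_null_rotation_isotropic_def by blast
  obtain c where c: "c \<in> A" "P\<^sub>o \<in> domain c"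
    using assms(2) unfolding manifold_def by blast
  define \<Omega> where "\<Omega> = {(a, x). x \<in> coord c ` domain c \<and> (a, coord_inv c x) \<in> D \<and>
      \<Psi> a (coord_inv c x) \<in> domain c}"
  define \<Phi> where "\<Phi> = (\<lambda>(a, x). coord c (\<Psi> a (coord_inv c x)))"
  interpret isometric_action_in_chart G \<Omega> \<Phi> "\<lambda>x. g c (coord_inv c x)"
    unfolding \<Omega>_def \<Phi>_def
    by (rule isometric_action_in_chart_of_group_of_motions[OF assms(1) motions c(1)])
  have inv: "coord_inv c (coord c P) = P" if "P \<in> domain c" for P
    using assms(1) c(1) that
    unfolding spacetime_def smooth_atlas_def is_chart_def homeomorphism_def by blast
  have D: "{0} \<times> W \<subseteq> D" "D \<subseteq> params G \<times> W"
    using motions unfolding group_of_motions_def local_transformation_group_def by blast+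
  define x\<^sub>0 where "x\<^sub>0 = coord c P\<^sub>o"
  have isotropy: "(\<gamma> s, x\<^sub>0) \<in> \<Omega> \<and> \<Phi> (\<gamma> s, x\<^sub>0) = x\<^sub>0"
    if "\<gamma> ` {-\<epsilon><..<\<epsilon>} \<subseteq> isotropy_subgroup D \<Psi> P\<^sub>o" "\<bar>s\<bar> < \<epsilon>" for \<epsilon> s and \<gamma> :: "real \<Rightarrow> real^'r"
  proof -
    have "s \<in> {-\<epsilon><..<\<epsilon>}" using that(2) by auto
    hence "\<gamma> s \<in> isotropy_subgroup D \<Psi> P\<^sub>o" using that(1) by blast
    thus ?thesis
      using c(2) inv unfolding isotropy_subgroup_def by (auto simp: \<Omega>_def \<Phi>_def x\<^sub>0_def)
  qed
  obtain q where q: "\<And>P. P \<in> W \<Longrightarrow> P \<in> domain c \<Longrightarrow> dim (orbit_tangent c \<Psi> P) = q"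
    and dim_isotropy: "dim (isotropy_algebra G D \<Psi> P\<^sub>o) > 0"
    using trans c P0 unfolding multiply_transitive_def by blast
  \<comment> \<open>The orbit tangent space is the range of the generators at the point, so
    constancy of the orbit dimension becomes constancy of this rank in the chart.\<close>
  have dims: "dim (range (\<lambda>w. generator w x)) = q" if x: "(0, x) \<in> \<Omega>" for x
  proof -
    define P where "P = coord_inv c x"
    have P: "P \<in> domain c" "P \<in> W"
      using x inv D(2) by (auto simp: \<Omega>_def P_def)
    have "((\<lambda>a. coord c (\<Psi> a P)) has_derivative (\<lambda>w. generator w x)) (at 0)"
      using has_derivative_partial(2)[OF action_has_derivative[OF x]]
      unfolding generator_def by (simp add: \<Phi>_def P_def)
    from frechet_derivative_at[OF this] show ?thesis
      using q[OF P(2,1)] unfolding orbit_tangent_def by (simp only:)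
  qed
  \<comment> \<open>Positive dimension of the isotropy algebra supplies the nonzero \<open>u\<close>
    whose generator vanishes at \<open>x\<^sub>0\<close>.\<close>
  have "\<not> isotropy_algebra G D \<Psi> P\<^sub>o \<subseteq> {0}"
    using dim_isotropy dim_eq_0 less_irrefl by metis
  then obtain u where u: "u \<noteq> 0" "u \<in> isotropy_algebra G D \<Psi> P\<^sub>o" by blast
  then obtain \<epsilon>' \<gamma>' where \<gamma>': "one_param_subgroup G \<epsilon>' \<gamma>'"
    "\<gamma>' ` {-\<epsilon>'<..<\<epsilon>'} \<subseteq> isotropy_subgroup D \<Psi> P\<^sub>o" "(\<gamma>' has_vector_derivative u) (at 0)"
    unfolding isotropy_algebra_def by blast
  have u0: "generator u x\<^sub>0 = 0"
    using \<gamma>'(1) unfolding one_param_subgroup_def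
    by (intro generator_eq_0_if_isotropy[OF _ \<gamma>'(3) _ isotropy[OF \<gamma>'(2)]]) auto
  \<comment> \<open>The null rotations enter through an element of the isotropy at
    \<open>P\<^sub>o\<close> whose differential is not the identity; for \<open>r \<le> 2\<close>
    this is contradicted below.\<close>
  obtain \<epsilon> \<gamma> where \<gamma>: "one_param_subgroup G \<epsilon> \<gamma>"
    "\<gamma> ` {-\<epsilon><..<\<epsilon>} \<subseteq> isotropy_subgroup D \<Psi> P\<^sub>o"
    and "\<exists>t\<in>{-\<epsilon><..<\<epsilon>}. differential c c (\<Psi> (\<gamma> t)) P\<^sub>o \<noteq> mat 1"
    using null c unfolding null_rotation_isotropy_def by blast
  then obtain t where "t \<in> {-\<epsilon><..<\<epsilon>}" and nontrivial: "differential c c (\<Psi> (\<gamma> t)) P\<^sub>o \<noteq> mat 1"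
    by blast
  hence t: "\<bar>t\<bar> < \<epsilon>" by auto
  have "CARD('r) \<ge> 3"
  proof (rule ccontr)
    assume "\<not> CARD('r) \<ge> 3"
    hence "CARD('r) \<le> 2" by simp
    from isotropy_representation_trivial_of_dim_le_2[OF this dims u(1) u0 \<gamma>(1) isotropy[OF \<gamma>(2)] t]
    have "frechet_derivative \<Phi> (at (\<gamma> t, x\<^sub>0)) (0, y) = y" for y .
    hence "((\<lambda>x. \<Phi> (\<gamma> t, x)) has_derivative (\<lambda>y. y)) (at x\<^sub>0)"
      using has_derivative_partial(1)[OF action_has_derivative] isotropy[OF \<gamma>(2) t] by fastforce
    moreover have "(\<lambda>x. \<Phi> (\<gamma> t, x)) = coord c \<circ> \<Psi> (\<gamma> t) \<circ> coord_inv c"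
      by (auto simp: \<Phi>_def)
    ultimately have "frechet_derivative (coord c \<circ> \<Psi> (\<gamma> t) \<circ> coord_inv c) (at x\<^sub>0) = (\<lambda>y. y)"
      using frechet_derivative_at by metis
    hence "differential c c (\<Psi> (\<gamma> t)) P\<^sub>o = mat 1"
      by (simp add: differential_def x\<^sub>0_def matrix_id_mat_1 flip: id_def)
    with nontrivial show False by contradiction
  qed
  with P0 motions trans show ?thesis by blast
qed

end
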